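(* Let $m,n,\ell\in\mathbb{N}=\{1,2,\dotsc\}$, let $\theta_k\in(0,1)$ for $1\le k\le\ell$ satisfy $\sum_{k=1}^{\ell}\theta_k=1$, let $y_1,\dotsc,y_\ell>0$, and let $\lambda=(\lambda_{ij})_{1\le i\le m,\,1\le j\le n}$ be a matrix with $\lambda_{ij}>0$ for all $1\le i\le m$ and $1\le j\le n$. Then $$ \frac{\prod_{j=1}^{n}\binom{\sum_{i=1}^{m}\lambda_{ij}\sum_{k=1}^{\ell}\theta_ky_k}{\lambda_{1j}\sum_{k=1}^{\ell}\theta_ky_k,\ \lambda_{2j}\sum_{k=1}^{\ell}\theta_ky_k,\ \dotsc,\ \lambda_{mj}\sum_{k=1}^{\ell}\theta_ky_k}}{\prod_{k=1}^{\ell}\Bigl[\prod_{j=1}^{n}\binom{\sum_{i=1}^{m}\lambda_{ij}y_k}{\lambda_{1j}y_k,\ \lambda_{2j}y_k,\ \dotsc,\ \lambda_{mj}y_k}\Bigr]^{\theta_k}} \le \frac{\prod_{k=1}^{\ell}\Bigl[\prod_{i=1}^{m}\binom{\sum_{j=1}^{n}\lambda_{ij}y_k}{\lambda_{i1}y_k,\ \lambda_{i2}y_k,\ \dotsc,\ \lambda_{in}y_k}\Bigr]^{\theta_k}}{\prod_{i=1}^{m}\binom{\sum_{j=1}^{n}\lambda_{ij}\sum_{k=1}^{\ell}\theta_ky_k}{\lambda_{i1}\sum_{k=1}^{\ell}\theta_ky_k,\ \lambda_{i2}\sum_{k=1}^{\ell}\theta_ky_k,\ \dotsc,\ \lambda_{in}\sum_{k=1}^{\ell}\theta_ky_k}}.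 $$
   Context: For positive real numbers $a_1,\dotsc,a_r$ ($r\in\mathbb{N}$), the (generalized) multinomial coefficient is $$ \binom{a_1+a_2+\dotsm+a_r}{a_1,a_2,\dotsc,a_r}=\frac{\Gamma\bigl(1+\sum_{i=1}^{r}a_i\bigr)}{\prod_{i=1}^{r}\Gamma(1+a_i)}, $$ where $\Gamma$ is the classical Euler gamma function. *)

theory Defs
  imports "HOL-Analysis.Gamma_Function"
begin

text \<open>
  The top entry of the coefficient is always the sum of the bottom entries, so it is
  not a separate argument. Meant for a finite index set \<open>I\<close> and positive \<open>a i\<close>.
\<close>
definition gen_multinomial :: "'i set \<Rightarrow> ('i \<Rightarrow> real) \<Rightarrow> real" where
  "gen_multinomial I a = Gamma (1 + (\<Sum>i\<in>I. a i)) / (\<Prod>i\<in>I. Gamma (1 + a i))"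

end

theory Submission imports Defs "HOL-Real_Asymp.Real_Asymp" begin

text \<open>
  Both sides are compared with \<open>1\<close>. Along a fixed ray of positive reals, the multinomial
  coefficient \<open>y \<mapsto> gen_multinomial I (\<lambda>i. a i * y)\<close> is log-convex on \<open>(0, \<infinity>)\<close>
  (\<open>convex_on_ln_gen_multinomial\<close>). By Jensen's inequality its value at \<open>\<Sum>k. \<theta> k * y k\<close> is at
  most the weighted geometric mean of its values at the \<open>y k\<close> (\<open>gen_multinomial_jensen\<close>).
  Multiplying over the columns of the matrix bounds the left-hand side by \<open>1\<close>; multiplying over
  the rows bounds the right-hand side from below by \<open>1\<close>.

  For the log-convexity, write \<open>\<psi>'\<close> for the trigamma function \<open>Polygamma 1\<close> and
  \<open>A = \<Sum>i. a i\<close>. The second derivative of the logarithm is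
  \<open>A\<^sup>2 * \<psi>' (1 + A * y) - (\<Sum>i. (a i)\<^sup>2 * \<psi>' (1 + a i * y))\<close>, so what is needed is that
  \<open>x\<^sup>2 * \<psi>' (1 + x)\<close> is superadditive. This follows as soon as \<open>x * \<psi>' (1 + x)\<close> is nondecreasing
  (\<open>trigamma_mult_mono\<close>), that is, \<open>\<psi>' (1 + x) + x * \<psi>'' (1 + x) \<ge> 0\<close>. Here
  \<open>\<psi>' (1 + x) \<ge> 1 / (1 + x)\<close> and \<open>- \<psi>'' (1 + x) \<le> 1 / (x * (1 + x))\<close>, both by comparing the
  defining series with telescoping ones, and these two bounds match exactly.
\<close>

section \<open>Monotonicity of the trigamma function times its argument\<close>

text \<open>
  With \<open>u = 1 + x + k\<close>, each term satisfies \<open>1 / u\<^sup>2 \<ge> 1 / (u * (u + 1)) = 1 / u - 1 / (u + 1)\<close>.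
\<close>
lemma trigamma_lower_bound:
  fixes x :: real
  assumes "x > -1"
  shows "1 / (1 + x) \<le> Polygamma 1 (1 + x)"
proof -
  have "(\<lambda>k. 1 / (1 + x + real k)) \<longlonglongrightarrow> 0"
    by real_asymp
  from telescope_sums'[OF this]
  have T: "(\<lambda>k. 1 / (1 + x + real k) - 1 / (1 + x + real (Suc k))) sums (1 / (1 + x))"
    by simp
  have P: "(\<lambda>k. inverse ((1 + x + real k) ^ 2)) sums Polygamma 1 (1 + x)"
    using Polygamma_LIMSEQ[of "1 + x" 1] assms by (simp add: numeral_2_eq_2)
  have "1 / u - 1 / (u + 1) \<le> inverse (u ^ 2)" if "u > 0" for u :: real
    using that by (simp add: divide_simps power2_eq_square)
  from this[of "1 + x + real k" for k]
  have "1 / (1 + x + real k) - 1 / (1 + x + real (Suc k)) \<le> inverse ((1 + x + real k) ^ 2)" for k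
    using assms by (simp add: add_ac)
  from sums_le[OF this T P] show ?thesis .
qed

text \<open>
  With \<open>u = 1 + x + k\<close>, each term satisfies
  \<open>2 / u ^ 3 \<le> 2 / ((u - 1) * u * (u + 1)) = 1 / ((u - 1) * u) - 1 / (u * (u + 1))\<close>.
\<close>
lemma tetragamma_lower_bound:
  fixes x :: real
  assumes "x > 0"
  shows "- 1 / (x * (1 + x)) \<le> Polygamma 2 (1 + x)"
proof -
  have "(\<lambda>k. 1 / ((x + real k) * (1 + x + real k))) \<longlonglongrightarrow> 0"
    by real_asymp
  from telescope_sums'[OF this]
  have T: "(\<lambda>k. 1 / ((x + real k) * (1 + x + real k))
              - 1 / ((x + real (Suc k)) * (1 + x + real (Suc k)))) sums (1 / (x * (1 + x)))"
    by simp
  have P: "(\<lambda>k. inverse ((1 + x + real k) ^ 3)) sums (- Polygamma 2 (1 + x) / 2)"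
    using Polygamma_LIMSEQ[of "1 + x" 2] assms by (simp add: numeral_3_eq_3 numeral_2_eq_2)
  have "2 * inverse (u ^ 3) \<le> 1 / ((u - 1) * u) - 1 / (u * (u + 1))" if "u > 1" for u :: real
  proof -
    have "1 < u * u"
      using that by (simp add: less_1_mult)
    hence "1 / ((u - 1) * u) - 1 / (u * (u + 1)) = 2 / (u * (u\<^sup>2 - 1))"
      using that by (simp add: divide_simps power2_eq_square) (simp add: algebra_simps)
    moreover have "2 * inverse (u ^ 3) = 2 / (u * u\<^sup>2)"
      by (simp add: divide_inverse power3_eq_cube power2_eq_square mult_ac)
    moreover have "2 / (u * u\<^sup>2) \<le> 2 / (u * (u\<^sup>2 - 1))"
      using that by (intro divide_left_mono mult_left_mono mult_pos_pos) auto
    ultimately show ?thesis by simp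
  qed
  from this[of "1 + x + real k" for k]
  have "2 * inverse ((1 + x + real k) ^ 3) \<le> 1 / ((x + real k) * (1 + x + real k))
          - 1 / ((x + real (Suc k)) * (1 + x + real (Suc k)))" for k
    using assms by (simp add: add_ac)
  from sums_le[OF this sums_mult[OF P, of 2] T] show ?thesis by simp
qed

lemma trigamma_mult_mono:
  fixes x y :: real
  assumes "0 < x" "x \<le> y"
  shows "x * Polygamma 1 (1 + x) \<le> y * Polygamma 1 (1 + y)"
proof (rule DERIV_nonneg_imp_nondecreasing[OF \<open>x \<le> y\<close>])
  fix t assume "x \<le> t" "t \<le> y"
  with assms have t: "t > 0" by simp
  have "((\<lambda>s. s * Polygamma 1 (1 + s)) has_real_derivative
          Polygamma 1 (1 + t) + t * Polygamma 2 (1 + t)) (at t)"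
    using t by (auto intro!: derivative_eq_intros simp: numeral_2_eq_2 elim!: nonpos_Ints_cases)
  moreover have "t * (- 1 / (t * (1 + t))) \<le> t * Polygamma 2 (1 + t)"
    using t by (intro mult_left_mono tetragamma_lower_bound) auto
  hence "0 \<le> Polygamma 1 (1 + t) + t * Polygamma 2 (1 + t)"
    using t trigamma_lower_bound[of t] by simp
  ultimately show "\<exists>d. ((\<lambda>s. s * Polygamma 1 (1 + s)) has_real_derivative d) (at t) \<and> 0 \<le> d"
    by blast
qed

section \<open>Log-convexity of multinomial coefficients along rays\<close>

lemma gen_multinomial_pos:
  assumes "\<And>i. i \<in> I \<Longrightarrow> a i > 0"
  shows "gen_multinomial I a > 0"
  unfolding gen_multinomial_def using assms
  by (intro divide_pos_pos prod_pos Gamma_real_pos add_pos_nonneg sum_nonneg ballI)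
     (auto intro: less_imp_le)

lemma ln_gen_multinomial:
  assumes "finite I" "\<And>i. i \<in> I \<Longrightarrow> a i > 0"
  shows "ln (gen_multinomial I a) = ln_Gamma (1 + (\<Sum>i\<in>I. a i)) - (\<Sum>i\<in>I. ln_Gamma (1 + a i))"
proof -
  have s: "1 + (\<Sum>i\<in>I. a i) > 0"
    using assms by (intro add_pos_nonneg sum_nonneg) (auto intro: less_imp_le)
  have G: "Gamma (1 + a i) > 0" "1 + a i > 0" if "i \<in> I" for i
    using assms(2)[OF that] by (auto intro!: Gamma_real_pos)
  have "ln (gen_multinomial I a) = ln (Gamma (1 + sum a I)) - ln (\<Prod>i\<in>I. Gamma (1 + a i))"
    unfolding gen_multinomial_def
    using G s by (intro ln_divide_pos Gamma_real_pos prod_pos) auto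
  also have "ln (\<Prod>i\<in>I. Gamma (1 + a i)) = (\<Sum>i\<in>I. ln (Gamma (1 + a i)))"
    using G(1)[THEN less_imp_neq] assms(1) by (intro ln_prod) metis+
  finally show ?thesis
    using s G by (simp add: ln_Gamma_real_pos)
qed

text \<open>
  Since \<open>a i * y \<le> A * y\<close> with \<open>A\<close> the sum of the \<open>a i\<close>, the monotonicity of
  \<open>x * Polygamma 1 (1 + x)\<close> gives
  \<open>a i * Polygamma 1 (1 + a i * y) \<le> A * Polygamma 1 (1 + A * y)\<close>. Weighting by \<open>a i\<close> and summing
  shows that the second derivative is nonnegative.
\<close>
lemma convex_on_ln_gen_multinomial:
  fixes a :: "'i \<Rightarrow> real"
  assumes I: "finite I" and a: "\<And>i. i \<in> I \<Longrightarrow> a i > 0"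
  shows "convex_on {0<..} (\<lambda>y. ln (gen_multinomial I (\<lambda>i. a i * y)))"
proof -
  define A where "A = (\<Sum>i\<in>I. a i)"
  have A: "A \<ge> 0"
    unfolding A_def using a by (intro sum_nonneg) (auto intro: less_imp_le)
  have le: "a i \<le> A" if "i \<in> I" for i
    unfolding A_def using that a I by (intro member_le_sum) (auto intro: less_imp_le)
  define f where "f y = ln_Gamma (1 + A * y) - (\<Sum>i\<in>I. ln_Gamma (1 + a i * y))" for y
  define f1 where "f1 y = A * Polygamma 0 (1 + A * y)
    - (\<Sum>i\<in>I. a i * Polygamma 0 (1 + a i * y))" for y
  define f2 where "f2 y = A * (A * Polygamma 1 (1 + A * y))
    - (\<Sum>i\<in>I. a i * (a i * Polygamma 1 (1 + a i * y)))" for y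
  have "convex_on {0<..} f"
  proof (rule f''_ge0_imp_convex)
    fix y :: real assume "y \<in> {0<..}"
    hence y: "y > 0" by simp
    have pA: "1 + A * y > 0" using A y by (simp add: add_pos_nonneg)
    have pa: "1 + a i * y > 0" if "i \<in> I" for i
      using a[OF that] y by (simp add: add_pos_pos)
    have chain: "((\<lambda>y. g (1 + c * y)) has_real_derivative c * g' (1 + c * y)) (at y)"
      if "1 + c * y > 0" "\<And>z. z > 0 \<Longrightarrow> (g has_real_derivative g' z) (at z)"
      for g g' :: "real \<Rightarrow> real" and c
      by (rule DERIV_cong[OF DERIV_chain2[where f = g and g = "\<lambda>y. 1 + c * y", OF that(2)[OF that(1)]]])
         (auto intro!: derivative_eq_intros)
    have psi: "(Polygamma 0 has_real_derivative Polygamma 1 z) (at z)" if "z > 0" for z :: real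
      using has_field_derivative_Polygamma[of z 0 UNIV] that by (simp add: nonpos_Ints_def)
    show "(f has_real_derivative f1 y) (at y)"
      unfolding f_def f1_def
      by (intro DERIV_diff DERIV_sum chain pA pa has_field_derivative_ln_Gamma_real)
    show "(f1 has_real_derivative f2 y) (at y)"
      unfolding f1_def f2_def
      by (intro DERIV_diff DERIV_sum DERIV_cmult chain pA pa psi)
    have "(\<Sum>i\<in>I. a i * (a i * Polygamma 1 (1 + a i * y)))
            \<le> (\<Sum>i\<in>I. a i * (A * Polygamma 1 (1 + A * y)))"
    proof (intro sum_mono mult_left_mono)
      fix i assume i: "i \<in> I"
      have "a i * y * Polygamma 1 (1 + a i * y) \<le> A * y * Polygamma 1 (1 + A * y)"
        using a[OF i] le[OF i] y by (intro trigamma_mult_mono mult_right_mono) auto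
      hence "(a i * Polygamma 1 (1 + a i * y)) * y \<le> (A * Polygamma 1 (1 + A * y)) * y"
        by (simp only: mult_ac)
      thus "a i * Polygamma 1 (1 + a i * y) \<le> A * Polygamma 1 (1 + A * y)"
        using y by (rule mult_right_le_imp_le)
      show "a i \<ge> 0" using a[OF i] by simp
    qed
    thus "f2 y \<ge> 0"
      unfolding f2_def by (simp add: sum_distrib_right[symmetric] A_def[symmetric])
  qed simp
  moreover have "ln (gen_multinomial I (\<lambda>i. a i * y)) = f y" if "y \<in> {0<..}" for y
    using that a I by (subst ln_gen_multinomial) (auto simp: f_def A_def sum_distrib_right)
  ultimately show ?thesis
    using convexD[OF convex_real_interval(3)[of 0]] unfolding convex_on_def by (simp add: add_pos_pos)
qed

lemma gen_multinomial_jensen: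
  fixes a :: "'i \<Rightarrow> real" and \<theta> y :: "'k \<Rightarrow> real"
  assumes "finite I" "\<And>i. i \<in> I \<Longrightarrow> a i > 0"
    and K: "finite K" "sum \<theta> K = 1" "\<And>k. k \<in> K \<Longrightarrow> \<theta> k \<ge> 0"
    and y: "\<And>k. k \<in> K \<Longrightarrow> y k > 0"
  shows "gen_multinomial I (\<lambda>i. a i * (\<Sum>k\<in>K. \<theta> k * y k))
           \<le> (\<Prod>k\<in>K. gen_multinomial I (\<lambda>i. a i * y k) powr \<theta> k)"
proof -
  define M where "M t = gen_multinomial I (\<lambda>i. a i * t)" for t
  define Y where "Y = (\<Sum>k\<in>K. \<theta> k * y k)"
  have M: "M t > 0" if "t > 0" for t
    unfolding M_def using that assms(2) by (intro gen_multinomial_pos) simp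
  have "K \<noteq> {}" using K(2) by auto
  have "Y \<in> {0<..}" 
    unfolding Y_def using convex_sum[OF K(1) _ K(2), of "{0<..}" y] K(3) y by simp
  hence "Y > 0" by simp
  have "ln (M Y) \<le> (\<Sum>k\<in>K. \<theta> k * ln (M (y k)))"
    using convex_on_sum[OF K(1) \<open>K \<noteq> {}\<close> convex_on_ln_gen_multinomial[of I a] K(2), of y] assms
    unfolding M_def Y_def by simp
  hence "exp (ln (M Y)) \<le> exp (\<Sum>k\<in>K. \<theta> k * ln (M (y k)))"
    by simp
  also have "\<dots> = (\<Prod>k\<in>K. M (y k) powr \<theta> k)"
    unfolding exp_sum[OF K(1)]
  proof (rule prod.cong)
    fix k assume "k \<in> K"
    with M[OF y] have "M (y k) > 0" by blast
    thus "exp (\<theta> k * ln (M (y k))) = M (y k) powr \<theta> k"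
      by (simp add: powr_def)
  qed simp
  finally show ?thesis
    using M[OF \<open>Y > 0\<close>] by (simp add: M_def Y_def)
qed

section \<open>The inequality for matrices\<close>

lemma prod_gen_multinomial_jensen:
  fixes a :: "'j \<Rightarrow> 'i \<Rightarrow> real" and \<theta> y :: "'k \<Rightarrow> real"
  assumes "finite I" "\<And>i j. i \<in> I \<Longrightarrow> j \<in> J \<Longrightarrow> a j i > 0"
    and "finite K" "sum \<theta> K = 1" "\<And>k. k \<in> K \<Longrightarrow> \<theta> k \<ge> 0"
    and "\<And>k. k \<in> K \<Longrightarrow> y k > 0"
  shows "(\<Prod>j\<in>J. gen_multinomial I (\<lambda>i. a j i * (\<Sum>k\<in>K. \<theta> k * y k)))
           \<le> (\<Prod>k\<in>K. (\<Prod>j\<in>J. gen_multinomial I (\<lambda>i. a j i * y k)) powr \<theta> k)"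
proof -
  have Y: "(\<Sum>k\<in>K. \<theta> k * y k) \<in> {0<..}"
    using convex_sum[OF assms(3) _ assms(4), of "{0<..}" y] assms(5,6) by simp
  have "(\<Prod>j\<in>J. gen_multinomial I (\<lambda>i. a j i * (\<Sum>k\<in>K. \<theta> k * y k)))
          \<le> (\<Prod>j\<in>J. \<Prod>k\<in>K. gen_multinomial I (\<lambda>i. a j i * y k) powr \<theta> k)"
    using assms Y
    by (intro prod_mono conjI gen_multinomial_jensen less_imp_le[OF gen_multinomial_pos]) auto
  also have "\<dots> = (\<Prod>k\<in>K. \<Prod>j\<in>J. gen_multinomial I (\<lambda>i. a j i * y k) powr \<theta> k)"
    by (rule prod.swap)
  finally show ?thesis
    by (simp add: prod_powr_distrib)
qed

theorem mainTheorem3: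
  fixes m n l :: nat
    and \<theta> y :: "nat \<Rightarrow> real"
    and lam :: "nat \<Rightarrow> nat \<Rightarrow> real"
  assumes "m \<ge> 1" and "n \<ge> 1" and "l \<ge> 1"
    and "\<And>k. k \<in> {1..l} \<Longrightarrow> 0 < \<theta> k \<and> \<theta> k < 1"
    and "(\<Sum>k=1..l. \<theta> k) = 1"
    and "\<And>k. k \<in> {1..l} \<Longrightarrow> y k > 0"
    and "\<And>i j. i \<in> {1..m} \<Longrightarrow> j \<in> {1..n} \<Longrightarrow> lam i j > 0"
  shows
    "(\<Prod>j=1..n. gen_multinomial {1..m} (\<lambda>i. lam i j * (\<Sum>k=1..l. \<theta> k * y k)))
       / (\<Prod>k=1..l. (\<Prod>j=1..n. gen_multinomial {1..m} (\<lambda>i. lam i j * y k)) powr \<theta> k)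
     \<le> (\<Prod>k=1..l. (\<Prod>i=1..m. gen_multinomial {1..n} (\<lambda>j. lam i j * y k)) powr \<theta> k)
       / (\<Prod>i=1..m. gen_multinomial {1..n} (\<lambda>j. lam i j * (\<Sum>k=1..l. \<theta> k * y k)))"
proof -
  let ?Y = "\<Sum>k=1..l. \<theta> k * y k"
  have \<theta>: "\<theta> k \<ge> 0" if "k \<in> {1..l}" for k
    using assms(4)[OF that] by simp
  have Y: "?Y \<in> {0<..}"
    using convex_sum[of "{1..l}" "{0<..}" \<theta> y] assms(5,6) \<theta> by simp
  have columns: "(\<Prod>j=1..n. gen_multinomial {1..m} (\<lambda>i. lam i j * ?Y))
      \<le> (\<Prod>k=1..l. (\<Prod>j=1..n. gen_multinomial {1..m} (\<lambda>i. lam i j * y k)) powr \<theta> k)"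
    by (rule prod_gen_multinomial_jensen[where a = "\<lambda>j i. lam i j"])
       (fact finite_atLeastAtMost assms \<theta> | blast intro: assms(7))+
  have rows: "(\<Prod>i=1..m. gen_multinomial {1..n} (\<lambda>j. lam i j * ?Y))
      \<le> (\<Prod>k=1..l. (\<Prod>i=1..m. gen_multinomial {1..n} (\<lambda>j. lam i j * y k)) powr \<theta> k)"
    by (rule prod_gen_multinomial_jensen[where a = "lam"])
       (fact finite_atLeastAtMost assms \<theta> | blast intro: assms(7))+
  have "0 < (\<Prod>j=1..n. gen_multinomial {1..m} (\<lambda>i. lam i j * ?Y))"
    "0 < (\<Prod>i=1..m. gen_multinomial {1..n} (\<lambda>j. lam i j * ?Y))"
    using Y assms(7) by (auto intro!: prod_pos gen_multinomial_pos)
  with columns rows show ?thesis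
    by (meson divide_le_eq_1_pos le_divide_eq_1_pos order_less_le_trans order_trans)
qed

end
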